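(* Let $z_0 \in \mathbb{C}\setminus\{0,1\}$. Then $$\zeta(z_0)=0 \iff (z_0-1)\sum_{n=1}^{\infty}\int_{0}^{1}\frac{t\,dt}{(n+t)^{z_0+1}}=1.$$
   Context: $\zeta$ denotes the Riemann zeta function, defined by $\zeta(z)=\sum_{n\ge1} n^{-z}$ for $\operatorname{Re} z>1$ and extended by analytic continuation to a meromorphic function whose only pole is a simple pole at $z=1$ with residue $1$. The continuation of $\zeta$ up to the boundary $\operatorname{Re} z=0$ is given by $\zeta(z)=1+\frac{1}{z-1}-z\sum_{n=1}^\infty\int_0^1\frac{t\,dt}{(n+t)^{z+1}}$. For real $s>0$ and complex $z$, $s^z = e^{z\log s}$ with $\log s$ the real logarithm.
   Formalization: The series converges only for Re z₀ > 0 (at z₀ = −2 it diverges although ζ(−2) = 0); the equivalence is stated literally for Re z₀ > 0, and for all z₀ ≠ 0, 1 with the sum replaced by its analytic continuation to C∖{0}. *)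

theory Defs
  imports "HOL-Complex_Analysis.Complex_Analysis"
begin

text \<open>
  The holomorphic function on \<open>V\<close> that agrees with \<open>f\<close> on \<open>U\<close>. Below, \<open>U\<close> is an open
  half-plane contained in the open connected set \<open>V\<close>, so the values on \<open>V\<close> are uniquely
  determined whenever such a function exists; values outside \<open>V\<close> are unspecified.
\<close>

definition analytic_continuation ::
    "(complex \<Rightarrow> complex) \<Rightarrow> complex set \<Rightarrow> complex set \<Rightarrow> complex \<Rightarrow> complex" where
  "analytic_continuation f U V =
     (SOME g. g holomorphic_on V \<and> (\<forall>z\<in>U. g z = f z))"

definition zeta :: "complex \<Rightarrow> complex" where
  "zeta = analytic_continuation
            (\<lambda>z. \<Sum>n. of_nat (Suc n) powr (- z)) {z. Re z > 1} (- {1})"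

text \<open>
  The series below starts at \<open>n = 1\<close>, so the base of the power is a positive real and
  \<open>powr\<close>, which uses the principal logarithm, agrees with the real logarithm there.
\<close>

definition frac_term :: "complex \<Rightarrow> nat \<Rightarrow> complex" where
  "frac_term z n =
     integral {0..1} (\<lambda>t::real. of_real t / of_real (real n + t) powr (z + 1))"

text \<open>
  The series \<open>\<Sum>n\<ge>1. frac_term z n\<close> converges exactly for \<open>Re z > 0\<close>; elsewhere its value
  is understood by analytic continuation. The continuation is regular at \<open>1\<close> and
  has a pole at \<open>0\<close>.
\<close>

definition frac_series :: "complex \<Rightarrow> complex" where
  "frac_series = analytic_continuation
                   (\<lambda>z. \<Sum>n. frac_term z (Suc n)) {z. Re z > 0} (- {0})"

end

theory Submission
  imports Defs
begin

text \<open>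
  Integration by parts gives \<open>z * (z - 1) * frac_series z = 1 - (z - 1) * (zeta z - 1)\<close> for
  \<open>Re z > 1\<close>, and the identity theorem carries this over to all \<open>z\<close> other than \<open>0\<close> and \<open>1\<close>,
  once both continuations are known to exist. For this, expand \<open>(m - 1) powr (1 - s)\<close> by Taylor's
  formula around \<open>m\<close> and sum over \<open>m \<ge> 2\<close>: the left-hand side telescopes, and the result
  expresses \<open>(s - 1) * (zeta s - 1)\<close> through the values of \<open>zeta\<close> at \<open>s + 1, s + 2, \<dots>\<close> and a
  remainder series that converges in a half-plane as large as desired. Hence
  \<open>(s - 1) * (zeta s - 1)\<close> extends to an entire function, one vertical strip at a time.
\<close>

section \<open>Locally uniform convergence of series on half-planes\<close>

text \<open>Weierstrass M-test: near any point of the half-plane \<open>B\<close> is bounded and the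
  exponent \<open>Re s + c\<close> stays above a constant greater than 1. The parameter
  \<open>c\<close> measures the gain in decay over the zeta series; the applications take it to be
  0, \<open>real K\<close> and 1.\<close>

lemma
  fixes f :: "nat \<Rightarrow> complex \<Rightarrow> complex" and B :: "complex \<Rightarrow> real" and c :: real
  assumes hol: "\<And>n. f n holomorphic_on {s. Re s > 1 - c}"
    and cont: "continuous_on {s. Re s > 1 - c} B"
    and le: "\<And>n s. Re s > 1 - c \<Longrightarrow> norm (f n s) \<le> B s * real (Suc n) powr (-(Re s + c))"
  shows summable_halfplane: "Re s > 1 - c \<Longrightarrow> summable (\<lambda>n. f n s)"
    and holomorphic_suminf_halfplane: "(\<lambda>s. \<Sum>n. f n s) holomorphic_on {s. Re s > 1 - c}"
proof -
  have summable_powr: "summable (\<lambda>n. K * real (Suc n) powr (-a))" if "a > 1" for a K :: real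
  proof -
    have "summable (\<lambda>n. real n powr (-a))"
      using that by (simp add: summable_real_powr_iff)
    then have "summable (\<lambda>n. real (Suc n) powr (-a))"
      by (rule summable_Suc_iff[THEN iffD2])
    then show ?thesis
      by (rule summable_mult)
  qed
  show "summable (\<lambda>n. f n s)" if "Re s > 1 - c"
    by (rule summable_comparison_test'[OF summable_powr[of "Re s + c" "B s"]]) (use that le in auto)
  show "(\<lambda>s. \<Sum>n. f n s) holomorphic_on {s. Re s > 1 - c}"
  proof (rule holomorphic_uniform_sequence[where f = "\<lambda>n s. \<Sum>i<n. f i s"])
    show "open {s. Re s > 1 - c}"
      by (rule open_halfspace_Re_gt)
    show "(\<lambda>s. \<Sum>i<n. f i s) holomorphic_on {s. Re s > 1 - c}" for n
      by (intro holomorphic_intros hol)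
    fix z assume "z \<in> {s. Re s > 1 - c}"
    \<comment> \<open>Half the distance from \<open>z\<close> to the boundary line, so on
      \<open>cball z d\<close> the exponent \<open>Re w + c\<close> is still at least
      \<open>1 + d\<close>.\<close>
    define d where "d = (Re z + c - 1) / 2"
    have "d > 0"
      using \<open>z \<in> _\<close> by (simp add: d_def)
    have Re_ge: "Re w + c \<ge> 1 + d" if "w \<in> cball z d" for w
    proof -
      have "Re z - Re w \<le> d"
        using that complex_Re_le_cmod[of "z - w"] by (simp add: dist_norm)
      moreover have "2 * d = Re z + c - 1"
        by (simp add: d_def)
      ultimately show ?thesis
        by linarith
    qed
    have sub: "cball z d \<subseteq> {s. Re s > 1 - c}"
      using Re_ge \<open>d > 0\<close> by force
    have "compact (B ` cball z d)"
      by (intro compact_continuous_image compact_cball continuous_on_subset[OF cont sub])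
    then obtain K where K: "\<And>w. w \<in> cball z d \<Longrightarrow> norm (B w) \<le> K"
      by (meson bounded_iff compact_imp_bounded imageI)
    have "uniform_limit (cball z d) (\<lambda>n s. \<Sum>i<n. f i s) (\<lambda>s. \<Sum>i. f i s) sequentially"
    proof (rule Weierstrass_m_test)
      show "summable (\<lambda>n. K * real (Suc n) powr (-(1 + d)))"
        using \<open>d > 0\<close> by (intro summable_powr) auto
      fix n w assume w: "w \<in> cball z d"
      have "norm (f n w) \<le> B w * real (Suc n) powr (-(Re w + c))"
        using w sub by (intro le) auto
      also have "\<dots> \<le> K * real (Suc n) powr (-(1 + d))"
        using K[OF w] Re_ge[OF w] by (intro mult_mono powr_mono) auto
      finally show "norm (f n w) \<le> K * real (Suc n) powr (-(1 + d))" .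
    qed
    with \<open>d > 0\<close> sub
    show "\<exists>d. 0 < d \<and> cball z d \<subseteq> {s. Re s > 1 - c} \<and>
            uniform_limit (cball z d) (\<lambda>n s. \<Sum>i<n. f i s) (\<lambda>s. \<Sum>i. f i s) sequentially"
      by blast
  qed
qed

section \<open>The zeta series without its first term\<close>

text \<open>Starts at 2 because expanding \<open>(m - 1) powr (1 - s)\<close> around
  \<open>m\<close> needs \<open>m - 1 > 0\<close>. It represents \<open>zeta s - 1\<close> for
  \<open>Re s > 1\<close>.\<close>

definition zeta_tail :: "complex \<Rightarrow> complex" where
  "zeta_tail s = (\<Sum>n. of_nat (Suc (Suc n)) powr (-s))"

lemma norm_of_nat_Suc_powr: "norm (of_nat (Suc n) powr s :: complex) = real (Suc n) powr Re s"
  using norm_powr_real_powr[of "of_nat (Suc n)" s] by simp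

lemma
  shows summable_zeta_tail: "Re s > 1 \<Longrightarrow> summable (\<lambda>n. of_nat (Suc (Suc n)) powr (-s) :: complex)"
    and holomorphic_zeta_tail: "zeta_tail holomorphic_on {s. Re s > 1}"
proof -
  have hol: "(\<lambda>s. of_nat (Suc (Suc n)) powr (-s) :: complex) holomorphic_on {s. Re s > 1 - 0}" for n
    by (intro holomorphic_intros)
  have le: "norm (of_nat (Suc (Suc n)) powr (-s) :: complex) \<le> 1 * real (Suc n) powr (-(Re s + 0))"
    if "Re s > 1 - 0" for n s
    using that unfolding norm_of_nat_Suc_powr by (simp add: powr_mono2')
  show "Re s > 1 \<Longrightarrow> summable (\<lambda>n. of_nat (Suc (Suc n)) powr (-s) :: complex)"
    using summable_halfplane[OF hol _ le] by simp
  show "zeta_tail holomorphic_on {s. Re s > 1}"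
    using holomorphic_suminf_halfplane[OF hol _ le] by (simp add: zeta_tail_def[abs_def])
qed

lemma sums_powr_telescope:
  assumes "Re s > 1"
  shows "(\<lambda>n. of_nat (Suc n) powr (1 - s) - of_nat (Suc (Suc n)) powr (1 - s) :: complex) sums 1"
proof -
  have "(\<lambda>n. of_nat (Suc n) powr (1 - s) :: complex) \<longlonglongrightarrow> 0"
    using assms by (intro tendsto_neg_powr_complex_of_nat filterlim_Suc) auto
  from telescope_sums'[OF this] show ?thesis
    by simp
qed

section \<open>Taylor remainders of powers and the shift identity\<close>

text \<open>The Taylor remainder of order \<open>K\<close> of \<open>x powr (1 - s)\<close> at
  \<open>m\<close>, expanded around \<open>m + 1\<close>. No signs appear: the step is -1, and its
  power \<open>(-1) ^ k\<close> cancels the sign of the \<open>k\<close>-th derivative.\<close>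

definition powr_rem :: "nat \<Rightarrow> nat \<Rightarrow> complex \<Rightarrow> complex" where
  "powr_rem K m s = of_nat m powr (1 - s) -
     (\<Sum>k\<le>K. pochhammer (s - 1) k / fact k * of_nat (Suc m) powr (1 - s - of_nat k))"

text \<open>Taylor's bound: the derivative of order \<open>Suc K\<close> is a multiple of
  \<open>x powr (-(s + K))\<close>. The hypothesis makes its modulus nonincreasing along the real
  segment, so the left end point \<open>Suc m\<close> gives the maximum.\<close>

lemma norm_powr_rem_le:
  assumes "Re s + real K \<ge> 0"
  shows "norm (powr_rem K (Suc m) s) \<le>
           norm (pochhammer (s - 1) (Suc K)) / fact K * real (Suc m) powr (-(Re s + real K))"
proof -
  \<comment> \<open>\<open>f i\<close> is the \<open>i\<close>-th derivative of
    \<open>x powr (1 - s)\<close>: the product of \<open>1 - s - j\<close> over \<open>j < i\<close>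
    equals \<open>(-1) ^ i * pochhammer (s - 1) i\<close>.\<close>
  define f where "f = (\<lambda>i x. (-1) ^ i * pochhammer (s - 1) i * x powr (1 - s - of_nat i))"
  define S where "S = closed_segment (of_nat (Suc m)) (of_nat (Suc (Suc m)) :: complex)"
  define B where "B = norm (pochhammer (s - 1) (Suc K)) * real (Suc m) powr (-(Re s + real K))"
  have S_real: "x \<in> \<real>" "Re x \<ge> real (Suc m)" if x: "x \<in> S" for x
  proof -
    obtain u where u: "0 \<le> u" "u \<le> 1"
      "x = (1 - u) *\<^sub>R of_nat (Suc m) + u *\<^sub>R of_nat (Suc (Suc m))"
      using x unfolding S_def closed_segment_def by blast
    have "x = of_real (real (Suc m) + u)"
      unfolding u by (simp add: scaleR_conv_of_real algebra_simps)
    then show "x \<in> \<real>" "Re x \<ge> real (Suc m)"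
      using u(1) by simp_all
  qed
  have "norm (f 0 (of_nat (Suc m)) -
          (\<Sum>i\<le>K. f i (of_nat (Suc (Suc m))) *
             (of_nat (Suc m) - of_nat (Suc (Suc m))) ^ i / fact i))
        \<le> B * norm (of_nat (Suc m) - of_nat (Suc (Suc m)) :: complex) ^ Suc K / fact K"
  proof (rule complex_Taylor[where S = S])
    show "convex S"
      by (simp add: S_def)
    show "of_nat (Suc m) \<in> S" "of_nat (Suc (Suc m)) \<in> S"
      by (simp_all add: S_def)
  next
    fix i x assume x: "x \<in> S"
    then have "x \<notin> \<real>\<^sub>\<le>\<^sub>0"
      using S_real[of x] by (auto simp: complex_nonpos_Reals_iff)
    then have "(f i has_field_derivative
        (-1) ^ i * pochhammer (s - 1) i * ((1 - s - of_nat i) * x powr (1 - s - of_nat i - 1)))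
        (at x within S)"
      unfolding f_def
      by (intro DERIV_cmult has_field_derivative_at_within[OF has_field_derivative_powr])
    also have "(-1) ^ i * pochhammer (s - 1) i * ((1 - s - of_nat i) * x powr (1 - s - of_nat i - 1))
      = f (Suc i) x"
      by (simp add: f_def pochhammer_Suc algebra_simps)
    finally show "(f i has_field_derivative f (Suc i) x) (at x within S)" .
  next
    fix x assume x: "x \<in> S"
    have "norm (f (Suc K) x) = norm (pochhammer (s - 1) (Suc K)) * Re x powr (-(Re s + real K))"
      using S_real[OF x] by (simp add: f_def norm_mult norm_power norm_powr_real_powr algebra_simps)
    also have "\<dots> \<le> B"
      unfolding B_def using assms S_real[OF x]
      by (intro mult_left_mono powr_mono2') auto
    finally show "norm (f (Suc K) x) \<le> B" .
  qed
  also have "f 0 (of_nat (Suc m)) -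
          (\<Sum>i\<le>K. f i (of_nat (Suc (Suc m))) *
             (of_nat (Suc m) - of_nat (Suc (Suc m))) ^ i / fact i) = powr_rem K (Suc m) s"
  proof -
    have "f i (of_nat (Suc (Suc m))) * (of_nat (Suc m) - of_nat (Suc (Suc m))) ^ i / fact i
        = pochhammer (s - 1) i / fact i * of_nat (Suc (Suc m)) powr (1 - s - of_nat i)" for i
    proof -
      have "of_nat (Suc m) - of_nat (Suc (Suc m)) = (-1 :: complex)"
        by simp
      moreover have "(-1) ^ i * (a * (-1) ^ i) = (a :: complex)" for a
        by (simp add: mult.left_commute flip: power_mult_distrib)
      ultimately show ?thesis
        by (simp only: f_def mult.assoc) simp
    qed
    then show ?thesis
      by (simp only: powr_rem_def) (simp add: f_def del: of_nat_Suc)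
  qed
  also have "norm (of_nat (Suc m) - of_nat (Suc (Suc m)) :: complex) = 1"
    by simp
  finally show ?thesis
    by (simp add: B_def)
qed

text \<open>Each further Taylor term gains one power of decay, so the general criterion applies with
  \<open>c = real K\<close> and the half-plane grows with \<open>K\<close>.\<close>

lemma
  shows summable_powr_rem: "Re s > 1 - real K \<Longrightarrow> summable (\<lambda>n. powr_rem K (Suc n) s)"
    and holomorphic_suminf_powr_rem:
      "(\<lambda>s. \<Sum>n. powr_rem K (Suc n) s) holomorphic_on {s. Re s > 1 - real K}"
proof -
  have hol: "powr_rem K (Suc n) holomorphic_on {s. Re s > 1 - real K}" for n
    unfolding powr_rem_def by (intro holomorphic_intros) auto
  have cont: "continuous_on {s. Re s > 1 - real K} (\<lambda>s. norm (pochhammer (s - 1) (Suc K)) / fact K)"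
    by (intro continuous_intros holomorphic_on_imp_continuous_on holomorphic_intros) auto
  have le: "norm (powr_rem K (Suc n) s) \<le>
      norm (pochhammer (s - 1) (Suc K)) / fact K * real (Suc n) powr (-(Re s + real K))"
    if "Re s > 1 - real K" for n s
    using that by (intro norm_powr_rem_le) auto
  show "Re s > 1 - real K \<Longrightarrow> summable (\<lambda>n. powr_rem K (Suc n) s)"
    by (rule summable_halfplane[OF hol cont le])
  show "(\<lambda>s. \<Sum>n. powr_rem K (Suc n) s) holomorphic_on {s. Re s > 1 - real K}"
    by (rule holomorphic_suminf_halfplane[OF hol cont le])
qed

text \<open>Sum the Taylor expansions around 2, 3, and so on. With the \<open>k = 0\<close> terms
  moved to the left, that side telescopes to 1. The \<open>k = 1\<close> summand is
  \<open>(s - 1) * zeta_tail s\<close>; the later ones evaluate \<open>zeta_tail\<close> further to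
  the right.\<close>

lemma zeta_tail_shift:
  assumes "Re s > 1"
  shows "1 = (\<Sum>k=1..K. pochhammer (s - 1) k / fact k * zeta_tail (s + of_nat k - 1))
              + (\<Sum>n. powr_rem K (Suc n) s)"
proof -
  have "(\<lambda>n. of_nat (Suc (Suc n)) powr (1 - s - of_nat k)) sums zeta_tail (s + of_nat k - 1)"
    if "k \<in> {1..K}" for k
  proof -
    have eq: "1 - s - of_nat k = - (s + of_nat k - 1)"
      by simp
    show ?thesis
      unfolding eq zeta_tail_def
      by (intro summable_sums summable_zeta_tail) (use assms that in auto)
  qed
  then have "(\<lambda>n. (\<Sum>k=1..K. pochhammer (s - 1) k / fact k * of_nat (Suc (Suc n)) powr (1 - s - of_nat k))
        + powr_rem K (Suc n) s) sums
      ((\<Sum>k=1..K. pochhammer (s - 1) k / fact k * zeta_tail (s + of_nat k - 1))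
              + (\<Sum>n. powr_rem K (Suc n) s))"
    using assms by (intro sums_add sums_sum sums_mult summable_sums summable_powr_rem) auto
  \<comment> \<open>The \<open>k = 0\<close> term inside \<open>powr_rem\<close> has no partner in
    the sum from 1 and survives as the second power.\<close>
  also have "(\<lambda>n. (\<Sum>k=1..K. pochhammer (s - 1) k / fact k * of_nat (Suc (Suc n)) powr (1 - s - of_nat k))
        + powr_rem K (Suc n) s) = (\<lambda>n. of_nat (Suc n) powr (1 - s) - of_nat (Suc (Suc n)) powr (1 - s))"
    by (simp add: powr_rem_def atMost_atLeast0 sum.atLeast_Suc_atMost del: of_nat_Suc)
  finally show ?thesis
    using sums_powr_telescope[OF assms] sums_unique2 by blast
qed

section \<open>Continuation of the zeta series, strip by strip\<close>

text \<open>
  In the \<open>k\<close>-th term of the shift identity the last factor \<open>s + k - 2\<close> of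
  \<open>pochhammer (s - 1) k\<close> cancels the pole of \<open>zeta_tail (s + k - 1)\<close>.
\<close>

lemma zeta_tail_continuation_halfplane:
  "\<exists>h. h holomorphic_on {s. Re s > 1 - real N} \<and> (\<forall>s. Re s > 1 \<longrightarrow> h s = (s - 1) * zeta_tail s)"
proof (induction N)
  case 0
  show ?case
    by (rule exI[of _ "\<lambda>s. (s - 1) * zeta_tail s"])
       (auto intro!: holomorphic_intros holomorphic_zeta_tail)
next
  case (Suc N)
  then obtain h where h: "h holomorphic_on {s. Re s > 1 - real N}"
    "\<And>s. Re s > 1 \<Longrightarrow> h s = (s - 1) * zeta_tail s"
    by blast
  \<comment> \<open>The shift identity with \<open>K = Suc N\<close>, solved for its
    \<open>k = 1\<close> term. For \<open>k \<ge> 2\<close> the argument \<open>s + k - 1\<close>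
    lies at least one unit to the right of \<open>s\<close>, hence in the domain of
    \<open>h\<close>, while the remainder series converges on the whole new half-plane.\<close>
  define h' where "h' = (\<lambda>s. 1 -
      (\<Sum>k=2..Suc N. pochhammer (s - 1) (k - 1) / fact k * h (s + of_nat k - 1))
      - (\<Sum>n. powr_rem (Suc N) (Suc n) s))"
  have "h' holomorphic_on {s. Re s > 1 - real (Suc N)}"
  proof -
    have "(\<lambda>s. h (s + of_nat k - 1)) holomorphic_on {s. Re s > 1 - real (Suc N)}"
      if "k \<in> {2..Suc N}" for k
    proof -
      have "(h \<circ> (\<lambda>s. s + of_nat k - 1)) holomorphic_on {s. Re s > 1 - real (Suc N)}"
        by (rule holomorphic_on_compose_gen[OF _ h(1)]) (use that in \<open>auto intro!: holomorphic_intros\<close>)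
      then show ?thesis
        by (simp add: o_def)
    qed
    then show ?thesis
      unfolding h'_def by (intro holomorphic_intros holomorphic_suminf_powr_rem) auto
  qed
  moreover have "h' s = (s - 1) * zeta_tail s" if s: "Re s > 1" for s
  proof -
    have "pochhammer (s - 1) (k - 1) / fact k * h (s + of_nat k - 1)
        = pochhammer (s - 1) k / fact k * zeta_tail (s + of_nat k - 1)" if k: "k \<in> {2..Suc N}" for k
    proof -
      have "Re (s + of_nat k - 1) > 1"
        using s k by simp
      moreover have "pochhammer (s - 1) k = pochhammer (s - 1) (k - 1) * (s + of_nat k - 1 - 1)"
        using k pochhammer_Suc[of "s - 1" "k - 1"] by (simp add: of_nat_diff algebra_simps)
      ultimately show ?thesis
        by (simp add: h(2))
    qed
    then have "h' s = 1 - (\<Sum>k=2..Suc N. pochhammer (s - 1) k / fact k * zeta_tail (s + of_nat k - 1))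
        - (\<Sum>n. powr_rem (Suc N) (Suc n) s)"
      unfolding h'_def by (simp only: cong: sum.cong)
    also have "\<dots> = (s - 1) * zeta_tail s"
      by (subst (1) zeta_tail_shift[OF s, of "Suc N"])
         (simp add: sum.atLeast_Suc_atMost numeral_2_eq_2 del: sum.cl_ivl_Suc)
    finally show ?thesis .
  qed
  ultimately show ?case
    by blast
qed

lemma connected_halfspace_Re_gt: "connected {s. Re s > b}"
  by (rule convex_connected[OF convex_halfspace_Re_gt])

text \<open>The extensions to the half-planes coincide for \<open>Re s > 1\<close>, hence by the
  identity theorem wherever two of them are defined, and so they glue to one entire
  function.\<close>

lemma zeta_tail_continuation:
  obtains h where "h holomorphic_on UNIV" "\<And>s. Re s > 1 \<Longrightarrow> h s = (s - 1) * zeta_tail s"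
proof -
  obtain h where hol: "\<And>N. h N holomorphic_on {s. Re s > 1 - real N}"
    and eq: "\<And>N s. Re s > 1 \<Longrightarrow> h N s = (s - 1) * zeta_tail s"
    using zeta_tail_continuation_halfplane by metis
  have le: "h M s = h N s" if "M \<le> N" "Re s > 1 - real M" for M N s
  proof (rule analytic_continuation_open
      [where s = "{s. Re s > 1}" and s' = "{s. Re s > 1 - real M}" and f = "h M" and g = "h N"])
    show "h N holomorphic_on {s. Re s > 1 - real M}"
      by (rule holomorphic_on_subset[OF hol]) (use that in auto)
    show "{s. Re s > 1} \<noteq> {}"
      by (auto intro: exI[of _ 2])
  qed (use that hol eq in \<open>auto simp: open_halfspace_Re_gt connected_halfspace_Re_gt\<close>)
  have agree: "h M s = h N s" if "Re s > 1 - real M" "Re s > 1 - real N" for M N s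
    using le[of M N s] le[of N M s] that by (metis nle_le)
  \<comment> \<open>The index is at least \<open>2 - Re s\<close>, so \<open>s\<close> lies inside
    the half-plane of the chosen \<open>h\<close>.\<close>
  define g where "g s = h (nat \<lceil>2 - Re s\<rceil>) s" for s
  have g: "g s = h N s" if "Re s > 1 - real N" for N s
    unfolding g_def by (rule agree) (use that in linarith)+
  show ?thesis
  proof
    have "g holomorphic_on (\<Union>N. {s. Re s > 1 - real N})"
    proof (rule holomorphic_on_UN_open)
      show "g holomorphic_on {s. Re s > 1 - real N}" for N
        by (rule holomorphic_transform[OF hol[of N]]) (simp add: g)
    qed (rule open_halfspace_Re_gt)
    also have "(\<Union>N. {s. Re s > 1 - real N}) = UNIV"
    proof -
      have "\<exists>N. Re s > 1 - real N" for s
        using reals_Archimedean2[of "1 - Re s"] by (auto simp: algebra_simps)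
      then show ?thesis
        by blast
    qed
    finally show "g holomorphic_on UNIV" .
    show "g s = (s - 1) * zeta_tail s" if "Re s > 1" for s
      using g[of 0 s] eq[of s 0] that by simp
  qed
qed

lemma suminf_zeta_eq:
  assumes "Re s > 1"
  shows "(\<Sum>n. of_nat (Suc n) powr (-s) :: complex) = 1 + zeta_tail s"
proof -
  have "summable (\<lambda>n. of_nat (Suc n) powr (-s) :: complex)"
    using summable_Suc_iff[of "\<lambda>n. of_nat (Suc n) powr (-s) :: complex"] summable_zeta_tail[OF assms]
    by simp
  from suminf_split_head[OF this] show ?thesis
    by (simp add: zeta_tail_def)
qed

section \<open>The series of integrals\<close>

text \<open>Obtained by integrating \<open>t (n + t) powr (-z - 1)\<close> by parts.\<close>

lemma frac_term_eq:
  "z * (z - 1) * frac_term z (Suc n) = (1 - z) * of_nat (Suc (Suc n)) powr (-z) +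
     (of_nat (Suc n) powr (1 - z) - of_nat (Suc (Suc n)) powr (1 - z))"
proof -
  define x where "x t = complex_of_real (real (Suc n) + t)" for t :: real
  \<comment> \<open>An antiderivative of \<open>z * (z - 1) * t / x t powr (z + 1)\<close>. Keeping
    the factor \<open>z * (z - 1)\<close> avoids dividing by it, so the identity holds for every
    \<open>z\<close>.\<close>
  define F where "F t = (1 - z) * of_real t * x t powr (-z) - x t powr (1 - z)" for t :: real
  have "((\<lambda>t. z * (z - 1) * (of_real t / x t powr (z + 1))) has_integral (F 1 - F 0)) {0..1}"
  proof (rule fundamental_theorem_of_calculus)
    fix t :: real assume t: "t \<in> {0..1}"
    define y where "y = x t"
    have y: "y \<notin> \<real>\<^sub>\<le>\<^sub>0" "y \<noteq> 0"
      using t unfolding y_def x_def by (auto simp: complex_nonpos_Reals_iff complex_eq_iff)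
    have der: "((\<lambda>t. x t powr a) has_vector_derivative a * y powr (a - 1)) (at t within {0..1})" for a
    proof -
      have "(x has_vector_derivative 1) (at t within {0..1})"
        unfolding x_def by (auto intro!: derivative_eq_intros)
      from field_vector_diff_chain_within[OF this, of "\<lambda>u. u powr a"]
        has_field_derivative_at_within[OF has_field_derivative_powr[OF y(1), of a]]
      show ?thesis
        by (simp add: o_def y_def)
    qed
    have "(F has_vector_derivative
        ((1 - z) * of_real t) * (- z * y powr (- z - 1)) + (1 - z) * y powr (-z) - (1 - z) * y powr (1 - z - 1))
        (at t within {0..1})"
      unfolding F_def
      by (rule has_vector_derivative_eq_rhs, (rule derivative_intros der)+)
         (auto simp: y_def)
    also have "((1 - z) * of_real t) * (- z * y powr (- z - 1)) + (1 - z) * y powr (-z)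
          - (1 - z) * y powr (1 - z - 1) = z * (z - 1) * (of_real t * y powr (-(z + 1)))"
    proof -
      have "((1 - z) * c) * (- z * a) + (1 - z) * b - (1 - z) * b = z * (z - 1) * (c * a)"
        for a b c
        by (simp add: algebra_simps)
      moreover have "1 - z - 1 = -z" "-(z + 1) = -z - 1"
        by simp_all
      ultimately show ?thesis
        by (simp only:)
    qed
    also have "\<dots> = z * (z - 1) * (of_real t / y powr (z + 1))"
      by (subst powr_minus) (simp add: field_simps)
    finally show "(F has_vector_derivative z * (z - 1) * (of_real t / x t powr (z + 1))) (at t within {0..1})"
      by (simp add: y_def)
  qed simp
  then have "integral {0..1} (\<lambda>t. z * (z - 1) * (of_real t / x t powr (z + 1))) = F 1 - F 0"
    by (rule integral_unique)
  then have "z * (z - 1) * frac_term z (Suc n) = F 1 - F 0"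
    by (simp only: frac_term_def x_def integral_mult_right)
  also have "x 1 = of_nat (Suc (Suc n))" "x 0 = of_nat (Suc n)"
    by (simp_all add: x_def)
  then have "F 1 - F 0 = (1 - z) * of_nat (Suc (Suc n)) powr (-z) +
     (of_nat (Suc n) powr (1 - z) - of_nat (Suc (Suc n)) powr (1 - z))"
    by (simp add: F_def)
  finally show ?thesis .
qed

text \<open>Each term is holomorphic by differentiation under the integral sign, and the integrand
  is at most \<open>real (Suc n) powr (-(Re z + 1))\<close> in modulus, which is the general
  criterion with \<open>c = 1\<close>.\<close>

lemma
  shows summable_frac_term: "Re z > 0 \<Longrightarrow> summable (\<lambda>n. frac_term z (Suc n))"
    and holomorphic_suminf_frac_term:
      "(\<lambda>z. \<Sum>n. frac_term z (Suc n)) holomorphic_on {z. Re z > 0}"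
proof -
  define x where "x n t = complex_of_real (real (Suc n) + t)" for n and t :: real
  have x: "x n t \<in> \<real>" "Re (x n t) \<ge> real (Suc n)" "x n t \<notin> \<real>\<^sub>\<le>\<^sub>0" "x n t \<noteq> 0" "Re (x n t) \<ge> 0"
    if "t \<in> {0..1}" for n t
    using that unfolding x_def by (auto simp: complex_nonpos_Reals_iff complex_eq_iff intro!: Reals_add)
  have ft: "frac_term z (Suc n) = integral (cbox 0 1) (\<lambda>t. of_real t / x n t powr (z + 1))" for z n
    by (simp add: frac_term_def x_def)
  have cont_x: "continuous_on A (\<lambda>y. x n (f y))" if "continuous_on A f"
    for n and f :: "'a::topological_space \<Rightarrow> real" and A
    unfolding x_def using that by (intro continuous_intros)
  have int: "(\<lambda>t. of_real t / x n t powr (z + 1)) integrable_on cbox 0 1" for n z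
    by (intro integrable_continuous continuous_intros cont_x) (use x in auto)
  \<comment> \<open>The bound \<open>1 - 1\<close> is left unsimplified so as to match
    \<open>1 - c\<close> in the general criterion.\<close>
  have hol: "(\<lambda>z. frac_term z (Suc n)) holomorphic_on {z. Re z > 1 - 1}" for n
    unfolding ft
  proof (rule leibniz_rule_holomorphic)
    fix z and t :: real assume "t \<in> cbox 0 1"
    with x(4)[of t n] have "((\<lambda>z. x n t powr (- z - 1)) has_field_derivative
        Ln (x n t) * x n t powr (- z - 1) * (- 1)) (at z within {z. Re z > 1 - 1})"
      by (intro DERIV_chain'[where g = "\<lambda>u. x n t powr u"] has_field_derivative_powr_right)
         (auto intro!: derivative_eq_intros)
    from DERIV_cmult[OF this, of "of_real t"]
    have "((\<lambda>z. of_real t * x n t powr (- z - 1)) has_field_derivative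
        - of_real t * Ln (x n t) * x n t powr (- z - 1)) (at z within {z. Re z > 1 - 1})"
      by (simp add: mult.assoc)
    moreover have "- u - 1 = - (u + 1)" for u :: complex
      by simp
    ultimately show "((\<lambda>z. of_real t / x n t powr (z + 1)) has_field_derivative
        - of_real t * Ln (x n t) / x n t powr (z + 1)) (at z within {z. Re z > 1 - 1})"
      by (simp only: powr_minus divide_inverse)
  next
    show "continuous_on ({z. Re z > 1 - 1} \<times> cbox 0 1)
        (\<lambda>(z, t). - of_real t * Ln (x n t) / x n t powr (z + 1))"
      unfolding case_prod_unfold
      by (intro continuous_intros cont_x) (use x in auto)
  qed (use int in \<open>auto simp: convex_halfspace_Re_gt\<close>)
  have le: "norm (frac_term z (Suc n)) \<le> 1 * real (Suc n) powr (-(Re z + 1))" if "Re z > 1 - 1" for n z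
  proof -
    have "norm (frac_term z (Suc n)) \<le> real (Suc n) powr (-(Re z + 1)) * measure lborel (cbox 0 (1::real))"
      unfolding ft
    proof (rule has_integral_bound[OF _ integrable_integral[OF int]])
      fix t :: real assume t: "t \<in> cbox 0 1"
      have "norm (of_real t / x n t powr (z + 1)) = t * inverse (Re (x n t) powr (Re z + 1))"
        using t x[of t n] by (simp add: norm_mult norm_inverse norm_powr_real_powr divide_inverse)
      also have "\<dots> = t * Re (x n t) powr (-(Re z + 1))"
        by (simp only: powr_minus)
      also have "\<dots> \<le> 1 * real (Suc n) powr (-(Re z + 1))"
        using t x[of t n] that by (intro mult_mono powr_mono2') auto
      finally show "norm (of_real t / x n t powr (z + 1)) \<le> real (Suc n) powr (-(Re z + 1))"
        by simp
    qed simp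
    then show ?thesis
      by simp
  qed
  show "Re z > 0 \<Longrightarrow> summable (\<lambda>n. frac_term z (Suc n))"
    using summable_halfplane[OF hol _ le] by simp
  show "(\<lambda>z. \<Sum>n. frac_term z (Suc n)) holomorphic_on {z. Re z > 0}"
    using holomorphic_suminf_halfplane[OF hol _ le] by simp
qed

text \<open>In the sum of \<open>frac_term_eq\<close> over \<open>n\<close>, the first part yields
  \<open>(1 - z) * zeta_tail z\<close> and the second telescopes to 1; for \<open>Re z > 1\<close>
  both parts converge separately.\<close>

lemma suminf_frac_term_eq:
  assumes "Re z > 1"
  shows "z * (z - 1) * (\<Sum>n. frac_term z (Suc n)) = 1 - (z - 1) * zeta_tail z"
proof -
  have "(\<lambda>n. z * (z - 1) * frac_term z (Suc n)) sums (z * (z - 1) * (\<Sum>n. frac_term z (Suc n)))"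
    using assms by (intro sums_mult summable_sums summable_frac_term) auto
  moreover have "(\<lambda>n. z * (z - 1) * frac_term z (Suc n)) sums ((1 - z) * zeta_tail z + 1)"
    unfolding frac_term_eq zeta_tail_def
    by (intro sums_add sums_mult summable_sums summable_zeta_tail sums_powr_telescope assms)
  ultimately have "z * (z - 1) * (\<Sum>n. frac_term z (Suc n)) = (1 - z) * zeta_tail z + 1"
    by (rule sums_unique2)
  then show ?thesis
    by (simp add: algebra_simps)
qed

section \<open>Existence of both continuations and the identity between them\<close>

text \<open>\<open>SOME\<close> satisfies its specification as soon as a witness exists, so each
  continuation reduces to exhibiting one function \<open>g\<close>.\<close>

lemma analytic_continuation_props:
  assumes "g holomorphic_on V" "\<And>z. z \<in> U \<Longrightarrow> g z = f z"
  shows "analytic_continuation f U V holomorphic_on V"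
    and "z \<in> U \<Longrightarrow> analytic_continuation f U V z = f z"
proof -
  have "analytic_continuation f U V holomorphic_on V \<and> (\<forall>z\<in>U. analytic_continuation f U V z = f z)"
    unfolding analytic_continuation_def by (rule someI[of _ g]) (use assms in blast)
  then show "analytic_continuation f U V holomorphic_on V"
    "z \<in> U \<Longrightarrow> analytic_continuation f U V z = f z"
    by blast+
qed

text \<open>The entire function \<open>h\<close> extends \<open>(s - 1) * (zeta s - 1)\<close>, so
  \<open>1 + h z / (z - 1)\<close> is a witness, singular at most at 1.\<close>

lemma
  shows holomorphic_zeta: "zeta holomorphic_on - {1}"
    and zeta_eq: "Re z > 1 \<Longrightarrow> zeta z = 1 + zeta_tail z"
proof -
  obtain h where h: "h holomorphic_on UNIV" "\<And>s. Re s > 1 \<Longrightarrow> h s = (s - 1) * zeta_tail s"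
    using zeta_tail_continuation by blast
  have hol: "(\<lambda>z. 1 + h z / (z - 1)) holomorphic_on - {1}"
    by (intro holomorphic_intros holomorphic_on_subset[OF h(1)]) auto
  have eq: "1 + h z / (z - 1) = (\<Sum>n. of_nat (Suc n) powr (-z))" if "z \<in> {z. Re z > 1}" for z
  proof -
    have "z \<noteq> 1"
      using that by auto
    with that show ?thesis
      by (simp add: suminf_zeta_eq h(2) del: of_nat_Suc)
  qed
  show "zeta holomorphic_on - {1}"
    unfolding zeta_def by (rule analytic_continuation_props(1)[OF hol eq])
  show "zeta z = 1 + zeta_tail z" if "Re z > 1"
  proof -
    have "zeta z = (\<Sum>n. of_nat (Suc n) powr (-z))"
      unfolding zeta_def by (rule analytic_continuation_props(2)[OF hol eq]) (use that in auto)
    with that show ?thesis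
      by (simp only: suminf_zeta_eq)
  qed
qed

text \<open>Two formulas are glued: the series itself on the right half-plane, and
  \<open>(1 - h z) / (z * (z - 1))\<close> away from 0 and 1.\<close>

lemma
  shows holomorphic_frac_series: "frac_series holomorphic_on - {0}"
    and frac_series_eq: "Re z > 0 \<Longrightarrow> frac_series z = (\<Sum>n. frac_term z (Suc n))"
proof -
  define F where "F = (\<lambda>z. \<Sum>n. frac_term z (Suc n))"
  define A where "A = {z. Re z > 0}"
  have F: "F holomorphic_on A"
    unfolding F_def A_def by (rule holomorphic_suminf_frac_term)
  have A: "open A" "connected A"
    by (simp_all add: A_def open_halfspace_Re_gt connected_halfspace_Re_gt)
  obtain h where h: "h holomorphic_on UNIV" "\<And>s. Re s > 1 \<Longrightarrow> h s = (s - 1) * zeta_tail s"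
    using zeta_tail_continuation by blast
  \<comment> \<open>Known for \<open>Re z > 1\<close>; the identity theorem carries it to
    \<open>Re z > 0\<close>, giving agreement on the overlap.\<close>
  have eq: "z * (z - 1) * F z = 1 - h z" if "z \<in> A" for z
  proof (rule analytic_continuation_open[where s = "{s. Re s > 1}" and s' = A
        and f = "\<lambda>z. z * (z - 1) * F z" and g = "\<lambda>z. 1 - h z"])
    show "{s. Re s > 1} \<noteq> {}"
      by (auto intro: exI[of _ 2])
    show "(\<lambda>z. z * (z - 1) * F z) holomorphic_on A"
      by (intro holomorphic_intros F)
    show "(\<lambda>z. 1 - h z) holomorphic_on A"
      by (intro holomorphic_intros holomorphic_on_subset[OF h(1)]) auto
  qed (use A that in \<open>auto simp: open_halfspace_Re_gt A_def F_def h(2) suminf_frac_term_eq\<close>)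
  \<comment> \<open>Since 1 lies in \<open>A\<close>, the series supplies the value at 1, where the
    quotient has denominator 0; only 0 remains excluded.\<close>
  have "(\<lambda>z. if z \<in> A then F z else (1 - h z) / (z * (z - 1))) holomorphic_on A \<union> - {0, 1}"
  proof (rule holomorphic_on_If_Un)
    show "(\<lambda>z. (1 - h z) / (z * (z - 1))) holomorphic_on - {0, 1}"
      by (intro holomorphic_intros holomorphic_on_subset[OF h(1)]) auto
    show "open (- {0, 1 :: complex})"
      by (intro open_Compl finite_imp_closed) auto
    show "F z = (1 - h z) / (z * (z - 1))" if "z \<in> A" "z \<in> - {0, 1}" for z
      using eq[OF that(1)] that(2) by (simp add: field_simps)
  qed (use F A in auto)
  also have "A \<union> - {0, 1} = - {0}"
    by (auto simp: A_def)
  finally have hol: "(\<lambda>z. if z \<in> A then F z else (1 - h z) / (z * (z - 1))) holomorphic_on - {0}" .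
  note * = analytic_continuation_props[OF hol, of A F]
  show "frac_series holomorphic_on - {0}"
    using *(1) by (simp add: frac_series_def F_def A_def)
  show "frac_series z = (\<Sum>n. frac_term z (Suc n))" if "Re z > 0"
    using *(2)[of z] that by (simp add: frac_series_def F_def A_def)
qed

text \<open>The plane without 0 and 1 is connected and both sides are holomorphic there. For
  \<open>Re z > 1\<close> the claim is \<open>suminf_frac_term_eq\<close>.\<close>

lemma frac_series_zeta:
  assumes "z \<noteq> 0" "z \<noteq> 1"
  shows "z * (z - 1) * frac_series z = 1 - (z - 1) * (zeta z - 1)"
proof (rule analytic_continuation_open[where s = "{s. Re s > 1}" and s' = "UNIV - {0, 1}"
      and f = "\<lambda>z. z * (z - 1) * frac_series z" and g = "\<lambda>z. 1 - (z - 1) * (zeta z - 1)"])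
  show "{s. Re s > 1} \<noteq> {}"
    by (auto intro: exI[of _ 2])
  show "open (UNIV - {0, 1 :: complex})"
    by (intro open_Diff finite_imp_closed) auto
  show "connected (UNIV - {0, 1 :: complex})"
    by (intro connected_open_delete_finite) auto
  show "(\<lambda>z. z * (z - 1) * frac_series z) holomorphic_on UNIV - {0, 1}"
    by (intro holomorphic_intros holomorphic_on_subset[OF holomorphic_frac_series]) auto
  show "(\<lambda>z. 1 - (z - 1) * (zeta z - 1)) holomorphic_on UNIV - {0, 1}"
    by (intro holomorphic_intros holomorphic_on_subset[OF holomorphic_zeta]) auto
qed (use assms in \<open>auto simp: open_halfspace_Re_gt frac_series_eq zeta_eq suminf_frac_term_eq\<close>)

text \<open>For \<open>Re z\<^sub>0 > 0\<close> the series is taken literally, and its convergence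
  is part of the claim; for general \<open>z\<^sub>0\<close> its continuation
  \<open>frac_series\<close> stands in for it.\<close>

theorem theorem2:
  fixes z\<^sub>0 :: complex
  assumes "z\<^sub>0 \<in> UNIV - {0, 1}"
  shows "(Re z\<^sub>0 > 0 \<longrightarrow>
            summable (\<lambda>n. frac_term z\<^sub>0 (Suc n)) \<and>
            (zeta z\<^sub>0 = 0 \<longleftrightarrow> (z\<^sub>0 - 1) * (\<Sum>n. frac_term z\<^sub>0 (Suc n)) = 1)) \<and>
         (zeta z\<^sub>0 = 0 \<longleftrightarrow> (z\<^sub>0 - 1) * frac_series z\<^sub>0 = 1)"
proof -
  have z: "z\<^sub>0 \<noteq> 0" "z\<^sub>0 - 1 \<noteq> 0"
    using assms by auto
  \<comment> \<open>On the right of \<open>frac_series_zeta\<close> the terms free of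
    \<open>zeta\<close> add up to \<open>1 + (z\<^sub>0 - 1)\<close>, that is
    \<open>z\<^sub>0\<close>, which can then be factored out.\<close>
  have "(z\<^sub>0 - 1) * zeta z\<^sub>0 = z\<^sub>0 * (1 - (z\<^sub>0 - 1) * frac_series z\<^sub>0)"
    using frac_series_zeta[of z\<^sub>0] z by (simp add: algebra_simps)
  with z have "zeta z\<^sub>0 = 0 \<longleftrightarrow> (z\<^sub>0 - 1) * frac_series z\<^sub>0 = 1"
    by (metis eq_iff_diff_eq_0 mult_eq_0_iff)
  then show ?thesis
    using summable_frac_term frac_series_eq by auto
qed

end
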